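(* Let $p$ be a prime, $K$ an F-finite field of characteristic $p$, and $I$ a proper monomial ideal, generated by finitely many (at least one) monomials, in $S=K[x_1,\dots,x_m]$. Suppose that $\lambda=\lambda_{\mathbf{b}}(I)$ is a critical exponent of $I$ (for some $\mathbf{b}\in\mathbb{N}^m$). Then $p\lambda$ is also a critical exponent of $I$, and so is its fractional part $p\lambda-\lceil p\lambda\rceil+1\in(0,1]$.
   Context: $K$ is F-finite if it is finitely generated over $K^p$. $q$ always denotes a power $p^e$, $e\ge 0$; $\mathbb{N}$ includes $0$. For an ideal $J\subseteq S$, $J^{[q]}=(f^q\mid f\in J)$ and $J^{[1/q]}$ is the smallest ideal $L$ with $L^{[q]}\supseteq J$. For an integer $k\ge 0$ with base $p$ expansion $k=k_0+k_1p+\cdots+k_rp^r$, $I^{[k]}=I^{k_0}(I^{k_1})^{[p]}\cdots(I^{k_r})^{[p^r]}$. Put $I^{[k/q]}=(I^{[k]})^{[1/q]}$. For real $\lambda\ge 0$, $I^{[\lambda]}$ is the stable value of the ascending chain $I^{[\lambda_1]}\subseteq I^{[\lambda_2]}\subseteq\cdots$ for any monotone decreasing sequence $(\lambda_j)$ of rationals of the form $k/q$ converging to $\lambda$ from above. A critical exponent of $I$ is a real number $\lambda>0$ such that $I^{[\mu]}\ne I^{[\lambda]}$ for all $0\le\mu<\lambda$. For $\mathbf{b}\in\mathbb{N}^m$, $\lambda_{\mathbf{b}}(I)=\sup\{\lambda\in\mathbb{R}_{\ge 0}\mid\mathbf{x}^{\mathbf{b}}\in I^{[\lambda]}\}$.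 Fractional parts are taken in $(0,1]$, i.e. with respect to nonterminating base $p$ expansions. *)

theory Defs
  imports Complex_Main "HOL-Library.Poly_Mapping" "HOL-Computational_Algebra.Primes"
begin

text \<open>The elements of \<open>('n, 'k) mpoly\<close> are the polynomials over \<open>'k\<close> in finitely many
  variables indexed by \<open>'n\<close>, so that \<open>m = CARD('n)\<close>; an exponent vector in \<open>\<nat>\<^sup>m\<close> is an
  element of \<open>'n \<Rightarrow>\<^sub>0 nat\<close>.\<close>

type_synonym ('n, 'k) mpoly = "('n \<Rightarrow>\<^sub>0 nat) \<Rightarrow>\<^sub>0 'k"

definition monomial :: "('n::finite \<Rightarrow>\<^sub>0 nat) \<Rightarrow> ('n, 'k::field) mpoly" where
  "monomial b = Poly_Mapping.single b 1"

text \<open>Finitely generated means finitely generated as a module over the subfield of \<open>p\<close>-th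
  powers. As the field is algebraic over that subfield, it is the same to ask for finite
  generation as a field extension.\<close>

definition F_finite :: "'k::field itself \<Rightarrow> bool" where
  "F_finite _ \<longleftrightarrow>
     (\<exists>B::'k set. finite B \<and> (\<forall>x. \<exists>c. x = (\<Sum>b\<in>B. c b ^ CHAR('k) * b)))"

text \<open>Ideals of a commutative ring are its submodules, so \<^const>\<open>module.subspace\<close> and
  \<^const>\<open>module.span\<close> with multiplication as scaling are the ideals and the generated ideals.\<close>

lemma module_times: "module ((*) :: 'a::comm_ring_1 \<Rightarrow> 'a \<Rightarrow> 'a)"
  by unfold_locales (simp_all add: algebra_simps)

abbreviation is_ideal :: "'a::comm_ring_1 set \<Rightarrow> bool" where
  "is_ideal \<equiv> module.subspace (*)"

abbreviation ideal_gen :: "'a::comm_ring_1 set \<Rightarrow> 'a set" where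
  "ideal_gen \<equiv> module.span (*)"

definition ideal_mult :: "'a::comm_ring_1 set \<Rightarrow> 'a set \<Rightarrow> 'a set" where
  "ideal_mult I J = ideal_gen {a * b | a b. a \<in> I \<and> b \<in> J}"

primrec ideal_pow :: "'a::comm_ring_1 set \<Rightarrow> nat \<Rightarrow> 'a set" where
  "ideal_pow I 0 = UNIV"
| "ideal_pow I (Suc n) = ideal_mult I (ideal_pow I n)"

definition frob_bracket :: "'a::comm_ring_1 set \<Rightarrow> nat \<Rightarrow> 'a set" where
  "frob_bracket J q = ideal_gen {f ^ q | f. f \<in> J}"

definition frob_root :: "'a::comm_ring_1 set \<Rightarrow> nat \<Rightarrow> 'a set" where
  "frob_root J q = (LEAST L. is_ideal L \<and> J \<subseteq> frob_bracket L q)"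

text \<open>The \<open>i\<close>-th base \<open>p\<close> digit of \<open>k\<close> is \<open>k div p ^ i mod p\<close>. It vanishes for \<open>i \<ge> k\<close>
  because \<open>k < p ^ k\<close>, and a vanishing digit contributes the unit ideal as a factor, so
  the indices \<open>0, \<dots>, k\<close> cover all digits.\<close>

definition frob_pow_nat :: "nat \<Rightarrow> 'a::comm_ring_1 set \<Rightarrow> nat \<Rightarrow> 'a set" where
  "frob_pow_nat p I k =
     foldr ideal_mult
       (map (\<lambda>i. frob_bracket (ideal_pow I (k div p ^ i mod p)) (p ^ i)) [0..<Suc k]) UNIV"

definition frob_pow_frac :: "nat \<Rightarrow> 'a::comm_ring_1 set \<Rightarrow> nat \<Rightarrow> nat \<Rightarrow> 'a set" where
  "frob_pow_frac p I k q = frob_root (frob_pow_nat p I k) q"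

text \<open>The exponents \<open>k j / p ^ e j\<close> approach \<open>t\<close> from above, that is, they are greater than \<open>t\<close>.\<close>

definition frob_pow :: "nat \<Rightarrow> 'a::comm_ring_1 set \<Rightarrow> real \<Rightarrow> 'a set" where
  "frob_pow p I t = (THE J. \<forall>(k :: nat \<Rightarrow> nat) (e :: nat \<Rightarrow> nat).
     decseq (\<lambda>j. real (k j) / real (p ^ e j)) \<longrightarrow>
     (\<forall>j. t < real (k j) / real (p ^ e j)) \<longrightarrow>
     (\<lambda>j. real (k j) / real (p ^ e j)) \<longlonglongrightarrow> t \<longrightarrow>
     (\<forall>\<^sub>F j in sequentially. frob_pow_frac p I (k j) (p ^ e j) = J))"

definition critical_exponent :: "nat \<Rightarrow> 'a::comm_ring_1 set \<Rightarrow> real \<Rightarrow> bool" where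
  "critical_exponent p I t \<longleftrightarrow>
     t > 0 \<and> (\<forall>u. 0 \<le> u \<and> u < t \<longrightarrow> frob_pow p I u \<noteq> frob_pow p I t)"

definition crit_exp :: "nat \<Rightarrow> ('n::finite, 'k::field) mpoly set \<Rightarrow> ('n \<Rightarrow>\<^sub>0 nat) \<Rightarrow> real" where
  "crit_exp p I b = Sup {t. 0 \<le> t \<and> monomial b \<in> frob_pow p I t}"

end

theory Submission
  imports Defs "HOL-Library.Set_Algebras"
begin

text \<open>For \<open>I\<close> generated by the monomials with exponents in \<open>A\<close>, the ideal \<open>I\<^bsup>[k]\<^esup>\<close> is generated
  by the monomials whose exponents are sums \<open>\<Sum>\<^sub>i p\<^sup>i s\<^sub>i\<close> with \<open>s\<^sub>i\<close> a sum of \<open>k\<^sub>i\<close> elements of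
  \<open>A\<close>. Hence \<open>x\<^sup>b \<in> I\<^bsup>[k/q]\<^esup>\<close> means that such a sum is componentwise smaller than \<open>q M\<close>, where
  \<open>M = b + 1\<close>, and this holds exactly if \<open>k/q\<close> is below a threshold \<open>\<lambda>(M)\<close>. So
  \<open>I\<^bsup>[t]\<^esup>\<close> is spanned by the \<open>x\<^sup>b\<close> with \<open>t < \<lambda>(b + 1)\<close>, we have \<open>\<lambda>\<^sub>b(I) = \<lambda>(b + 1)\<close>, and all these
  values are critical. The first claim is then \<open>\<lambda>(p M) = p \<lambda>(M)\<close>.

  For the fractional part, let \<open>\<lambda>(M) = n + f\<close> with \<open>0 < f \<le> 1\<close>. For every \<open>q\<close> some sum for
  \<open>n q + (\<lceil>q f\<rceil> - 1)\<close> fits below \<open>q M\<close>, and it splits as \<open>q a + a'\<close> with \<open>a\<close> a sum for \<open>n\<close>.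
  An \<open>a\<close> that occurs for infinitely many \<open>q\<close> gives \<open>\<lambda>(M - a) = f\<close>, unless \<open>f = 1\<close> and \<open>p\<close> divides
  \<open>n + 1\<close>, where adding one element of \<open>A\<close> to \<open>a\<close> carries. In that case
  \<open>\<lambda>(\<lceil>M/p\<rceil>) = \<lambda>(M)/p\<close> is a smaller integer, which allows induction.\<close>

section \<open>Ideals and exponent vectors\<close>

lemmas ideal_gen_base = module.span_base[OF module_times]
  and ideal_gen_minimal = module.span_minimal[OF module_times]
  and ideal_gen_mono = module.span_mono[OF module_times]
  and is_ideal_ideal_gen = module.subspace_span[OF module_times]
  and is_idealI = module.subspaceI[OF module_times]
  and is_ideal_0 = module.subspace_0[OF module_times]
  and is_ideal_add = module.subspace_add[OF module_times]
  and is_ideal_mult = module.subspace_scale[OF module_times]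
  and is_ideal_sum = module.subspace_sum[OF module_times]

abbreviation lookup :: "('a \<Rightarrow>\<^sub>0 'b::zero) \<Rightarrow> 'a \<Rightarrow> 'b" where
  "lookup \<equiv> Poly_Mapping.lookup"

abbreviation keys :: "('a \<Rightarrow>\<^sub>0 'b::zero) \<Rightarrow> 'a set" where
  "keys \<equiv> Poly_Mapping.keys"

definition scale_exp :: "nat \<Rightarrow> ('n \<Rightarrow>\<^sub>0 nat) \<Rightarrow> ('n \<Rightarrow>\<^sub>0 nat)" where
  "scale_exp q = Poly_Mapping.map ((*) q)"

definition div_exp :: "('n \<Rightarrow>\<^sub>0 nat) \<Rightarrow> nat \<Rightarrow> ('n \<Rightarrow>\<^sub>0 nat)" where
  "div_exp a q = Poly_Mapping.map (\<lambda>x. x div q) a"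

lemma lookup_scale_exp [simp]: "lookup (scale_exp q a) i = q * lookup a i"
  by (simp add: scale_exp_def Poly_Mapping.map.rep_eq when_def)

lemma lookup_div_exp [simp]: "lookup (div_exp a q) i = lookup a i div q"
  by (simp add: div_exp_def Poly_Mapping.map.rep_eq when_def)

lemma scale_exp_add: "scale_exp q (a + b) = scale_exp q a + scale_exp q b"
  by (rule poly_mapping_eqI) (simp add: lookup_add algebra_simps)

lemma scale_exp_scale_exp: "scale_exp q (scale_exp r a) = scale_exp (q * r) a"
  by (rule poly_mapping_eqI) simp

lemma scale_exp_1 [simp]: "scale_exp 1 a = a" "scale_exp (Suc 0) a = a"
  by (rule poly_mapping_eqI, simp)+

lemma scale_exp_0 [simp]: "scale_exp 0 a = 0"
  by (rule poly_mapping_eqI) simp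

lemma scale_exp_Suc: "scale_exp (Suc q) a = a + scale_exp q a"
  by (rule poly_mapping_eqI) (simp add: lookup_add)

lemma scale_exp_0_right [simp]: "scale_exp q 0 = 0"
  by (rule poly_mapping_eqI) simp

lemma mem_plus_UNIV_iff:
  fixes V :: "('n \<Rightarrow>\<^sub>0 nat) set"
  shows "c \<in> V + UNIV \<longleftrightarrow> (\<exists>a\<in>V. \<forall>i. lookup a i \<le> lookup c i)"
proof
  assume "\<exists>a\<in>V. \<forall>i. lookup a i \<le> lookup c i"
  then obtain a where a: "a \<in> V" "\<And>i. lookup a i \<le> lookup c i" by blast
  have "c = a + (c - a)"
    by (rule poly_mapping_eqI) (use a(2) in \<open>simp add: lookup_add lookup_minus\<close>)
  then show "c \<in> V + UNIV" using a(1) by (metis UNIV_I set_plus_intro)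
qed (force simp: set_plus_def lookup_add)

lemma poly_mapping_sum_single: "f = (\<Sum>c\<in>keys f. Poly_Mapping.single c (lookup f c))"
  by (rule poly_mapping_eqI)
     (auto simp: lookup_sum lookup_single when_def in_keys_iff sum.delta)

lemma monomial_add: "monomial (a + b) = monomial a * monomial b"
  by (simp add: monomial_def mult_single)

lemma single_power:
  "Poly_Mapping.single c (v :: 'k::comm_semiring_1) ^ n = Poly_Mapping.single (scale_exp n c) (v ^ n)"
  by (induction n) (simp_all add: scale_exp_Suc mult_single)

lemma monomial_power: "monomial a ^ q = monomial (scale_exp q a)"
  by (simp add: monomial_def single_power)

lemma keys_monomial [simp]: "keys (monomial a :: ('n::finite, 'k::field) mpoly) = {a}"
  by (simp add: monomial_def)

section \<open>Monomial ideals, their products and powers\<close>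

lemma is_ideal_keys_subset:
  fixes V :: "('n::finite \<Rightarrow>\<^sub>0 nat) set"
  shows "is_ideal {f :: ('n, 'k::field) mpoly. keys f \<subseteq> V + UNIV}"
proof (rule is_idealI)
  fix c f :: "('n, 'k) mpoly"
  assume "f \<in> {f. keys f \<subseteq> V + UNIV}"
  then have f: "keys f \<subseteq> V + UNIV" by simp
  have "keys (c * f) \<subseteq> V + UNIV"
  proof
    fix x assume "x \<in> keys (c * f)"
    then obtain u v where "x = u + v" "v \<in> keys f" using keys_mult[of c f] by blast
    moreover from this obtain a d where "a \<in> V" "v = a + d"
      using f by (blast elim: set_plus_elim)
    ultimately have "a \<in> V" "x = a + (u + d)" by (simp_all add: ac_simps)
    then show "x \<in> V + UNIV" by blast
  qed
  then show "c * f \<in> {f. keys f \<subseteq> V + UNIV}" by simp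
next
  fix f g :: "('n, 'k) mpoly"
  assume "f \<in> {f. keys f \<subseteq> V + UNIV}" "g \<in> {f. keys f \<subseteq> V + UNIV}"
  then show "f + g \<in> {f. keys f \<subseteq> V + UNIV}" using keys_add[of f g] by blast
qed simp

text \<open>A polynomial is the sum of its terms, and a term with exponent in
  \<open>V + UNIV\<close> is a multiple of a generator. Ideal membership thus becomes a question
  about supports.\<close>

lemma ideal_gen_monomial:
  fixes V :: "('n::finite \<Rightarrow>\<^sub>0 nat) set"
  shows "ideal_gen (monomial ` V) = {f :: ('n, 'k::field) mpoly. keys f \<subseteq> V + UNIV}"
proof
  show "ideal_gen (monomial ` V) \<subseteq> {f :: ('n, 'k) mpoly. keys f \<subseteq> V + UNIV}"
    by (rule ideal_gen_minimal[OF _ is_ideal_keys_subset]) (force simp: mem_plus_UNIV_iff)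
next
  show "{f :: ('n, 'k) mpoly. keys f \<subseteq> V + UNIV} \<subseteq> ideal_gen (monomial ` V)"
  proof
    fix f :: "('n, 'k) mpoly" assume "f \<in> {f. keys f \<subseteq> V + UNIV}"
    then have f: "keys f \<subseteq> V + UNIV" by simp
    have "Poly_Mapping.single c (lookup f c) \<in> ideal_gen (monomial ` V)" if c: "c \<in> keys f" for c
    proof -
      obtain a d where ad: "a \<in> V" "c = a + d" using f c by (blast elim: set_plus_elim)
      have "Poly_Mapping.single c (lookup f c) = Poly_Mapping.single d (lookup f c) * monomial a"
        by (simp add: ad(2) monomial_def mult_single add.commute)
      then show ?thesis using ad(1)
        by (auto intro: is_ideal_mult[OF is_ideal_ideal_gen] ideal_gen_base)
    qed
    then show "f \<in> ideal_gen (monomial ` V)"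
      by (subst poly_mapping_sum_single) (intro is_ideal_sum is_ideal_ideal_gen)
  qed
qed

lemma ideal_gen_monomial_0: "ideal_gen (monomial ` {0}) = (UNIV :: ('n::finite, 'k::field) mpoly set)"
  unfolding ideal_gen_monomial by simp

lemma ideal_mult_monomial:
  fixes V W :: "('n::finite \<Rightarrow>\<^sub>0 nat) set"
  shows "ideal_mult (ideal_gen (monomial ` V)) (ideal_gen (monomial ` W)) =
    (ideal_gen (monomial ` (V + W)) :: ('n, 'k::field) mpoly set)"
proof
  show "ideal_mult (ideal_gen (monomial ` V)) (ideal_gen (monomial ` W)) \<subseteq>
    (ideal_gen (monomial ` (V + W)) :: ('n, 'k) mpoly set)"
    unfolding ideal_mult_def
  proof (rule ideal_gen_minimal[OF _ is_ideal_ideal_gen], safe)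
    fix f g :: "('n, 'k) mpoly"
    assume "f \<in> ideal_gen (monomial ` V)" "g \<in> ideal_gen (monomial ` W)"
    then have fg: "keys f \<subseteq> V + UNIV" "keys g \<subseteq> W + UNIV"
      by (simp_all add: ideal_gen_monomial)
    have "keys (f * g) \<subseteq> V + W + UNIV"
    proof
      fix x assume "x \<in> keys (f * g)"
      then obtain u v where "x = u + v" "u \<in> V + UNIV" "v \<in> W + UNIV"
        using keys_mult[of f g] fg by blast
      then obtain a b c d where "a \<in> V" "b \<in> W" "x = (a + b) + (c + d)"
        by (auto simp: set_plus_def ac_simps)
      then show "x \<in> V + W + UNIV" by blast
    qed
    then show "f * g \<in> ideal_gen (monomial ` (V + W))" by (simp add: ideal_gen_monomial)
  qed
next
  show "(ideal_gen (monomial ` (V + W)) :: ('n, 'k) mpoly set) \<subseteq>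
    ideal_mult (ideal_gen (monomial ` V)) (ideal_gen (monomial ` W))"
    unfolding ideal_mult_def
    by (rule ideal_gen_mono) (auto simp: monomial_add elim!: set_plus_elim intro!: exI ideal_gen_base)
qed

primrec sumset_pow :: "'a::comm_monoid_add set \<Rightarrow> nat \<Rightarrow> 'a set" where
  "sumset_pow A 0 = {0}"
| "sumset_pow A (Suc n) = A + sumset_pow A n"

lemma ideal_pow_monomial:
  fixes V :: "('n::finite \<Rightarrow>\<^sub>0 nat) set"
  shows "ideal_pow (ideal_gen (monomial ` V)) n =
    (ideal_gen (monomial ` sumset_pow V n) :: ('n, 'k::field) mpoly set)"
  by (induction n) (simp_all add: ideal_mult_monomial flip: ideal_gen_monomial_0 del: image_insert)

section \<open>Frobenius powers and Frobenius roots of monomial ideals\<close>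

lemma CHAR_mpoly: "CHAR(('n, 'k::field) mpoly) = CHAR('k)"
proof (rule CHAR_eqI)
  fix x :: nat assume "of_nat x = (0 :: ('n, 'k) mpoly)"
  then have "lookup (of_nat x :: ('n, 'k) mpoly) 0 = 0" by simp
  then show "CHAR('k) dvd x"
    by (simp add: lookup_of_nat of_nat_eq_0_iff_char_dvd)
qed (simp flip: single_of_nat)

text \<open>In prime characteristic \<open>f ^ q\<close> is the sum of the \<open>q\<close>-th
  powers of the terms of \<open>f\<close>, each of them a multiple of the \<open>q\<close>-th power
  of a generator.\<close>

lemma frob_bracket_monomial:
  fixes V :: "('n::finite \<Rightarrow>\<^sub>0 nat) set"
  assumes "prime CHAR('k)" and q: "q = CHAR('k::field) ^ e"
  shows "frob_bracket (ideal_gen (monomial ` V)) q =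
    (ideal_gen (monomial ` scale_exp q ` V) :: ('n, 'k) mpoly set)"
proof
  show "frob_bracket (ideal_gen (monomial ` V)) q \<subseteq>
    (ideal_gen (monomial ` scale_exp q ` V) :: ('n, 'k) mpoly set)"
    unfolding frob_bracket_def
  proof (rule ideal_gen_minimal[OF _ is_ideal_ideal_gen], safe)
    fix f :: "('n, 'k) mpoly" assume "f \<in> ideal_gen (monomial ` V)"
    then have f: "keys f \<subseteq> V + UNIV" by (simp add: ideal_gen_monomial)
    have "f ^ q = (\<Sum>c\<in>keys f. Poly_Mapping.single c (lookup f c) ^ q)"
      by (subst poly_mapping_sum_single, rule freshmans_dream_sum') (use assms in \<open>auto simp: CHAR_mpoly\<close>)
    also have "\<dots> \<in> ideal_gen (monomial ` scale_exp q ` V)"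
    proof (rule is_ideal_sum[OF is_ideal_ideal_gen])
      fix c assume "c \<in> keys f"
      then obtain a d where ad: "a \<in> V" "c = a + d" using f by (blast elim: set_plus_elim)
      have "Poly_Mapping.single c (lookup f c) = Poly_Mapping.single d (lookup f c) * monomial a"
        by (simp add: ad(2) monomial_def mult_single add.commute)
      then have "Poly_Mapping.single c (lookup f c) ^ q =
          Poly_Mapping.single d (lookup f c) ^ q * monomial (scale_exp q a)"
        by (simp add: power_mult_distrib monomial_power)
      then show "Poly_Mapping.single c (lookup f c) ^ q \<in> ideal_gen (monomial ` scale_exp q ` V)"
        using ad(1) by (auto intro: is_ideal_mult[OF is_ideal_ideal_gen] ideal_gen_base)
    qed
    finally show "f ^ q \<in> ideal_gen (monomial ` scale_exp q ` V)" .
  qed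
next
  show "(ideal_gen (monomial ` scale_exp q ` V) :: ('n, 'k) mpoly set) \<subseteq>
    frob_bracket (ideal_gen (monomial ` V)) q"
    unfolding frob_bracket_def
    by (rule ideal_gen_mono) (auto simp flip: monomial_power intro!: exI ideal_gen_base)
qed

text \<open>With \<open>c\<close> acting as multiplication by \<open>c ^ q\<close>, the field is a
  vector space over itself. A linear map to the ordinary structure may be prescribed at the nonzero
  vector 1 and extended.\<close>

lemma exists_frobenius_splitting:
  assumes "prime CHAR('k::field)" and q: "q = CHAR('k) ^ e"
  obtains \<phi> :: "'k \<Rightarrow> 'k::field" where "\<phi> 1 = 1" and "\<And>x y. \<phi> (x + y) = \<phi> x + \<phi> y"
    and "\<And>c x. \<phi> (c ^ q * x) = c * \<phi> x"
proof -
  have "q > 0" using assms by (simp add: prime_gt_0_nat)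
  interpret vector_space_pair "\<lambda>(c::'k) (x::'k). c ^ q * x" "(*) :: 'k \<Rightarrow> 'k \<Rightarrow> 'k"
    by unfold_locales
       (use \<open>q > 0\<close> in \<open>simp_all add: algebra_simps power_mult_distrib freshmans_dream'[OF assms]\<close>)
  have "vs1.independent {1}"
    by (simp only: vs1.dependent_single one_neq_zero not_False_eq_True)
  from linear_independent_extend[OF this, of "\<lambda>x. x"] obtain g
    where g: "Vector_Spaces.linear (\<lambda>(c::'k) (x::'k). c ^ q * x) (*) g" "g 1 = 1" by auto
  from linear_add[OF g(1)] linear_scale[OF g(1)] g(2) show ?thesis
    by (intro that[of g]) auto
qed

text \<open>Every ideal \<open>L\<close> with \<open>x\<^sup>a \<in> L\<^bsup>[q]\<^esup>\<close> contains the image of \<open>x\<^sup>a\<close> under the additive map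
  \<open>T\<close> that sends \<open>c x\<^bsup>qd + r\<^esup>\<close> with \<open>r = a mod q\<close> to \<open>\<phi> c x\<^sup>d\<close> and the other terms to \<open>0\<close>,
  because \<open>T (h f\<^sup>q) = T h f\<close>.\<close>

lemma monomial_mem_frob_bracket:
  fixes L :: "('n::finite, 'k::field) mpoly set"
  assumes "prime CHAR('k)" and q: "q = CHAR('k) ^ e"
    and L: "is_ideal L" and a: "monomial a \<in> frob_bracket L q"
  shows "monomial (div_exp a q) \<in> L"
proof -
  have "q > 0" using assms by (simp add: prime_gt_0_nat)
  obtain \<phi> :: "'k \<Rightarrow> 'k" where \<phi>: "\<phi> 1 = 1" "\<And>x y. \<phi> (x + y) = \<phi> x + \<phi> y"
      "\<And>c x. \<phi> (c ^ q * x) = c * \<phi> x"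
    using exists_frobenius_splitting[OF assms(1,2)] by metis
  have \<phi>0: "\<phi> 0 = 0" using \<phi>(3)[of 0 0] by simp
  define r where "r = Poly_Mapping.map (\<lambda>x. x mod q) a"
  have r: "lookup r i = lookup a i mod q" for i
    by (simp add: r_def Poly_Mapping.map.rep_eq when_def)
  \<comment> \<open>\<open>\<iota>\<close> lists the exponents congruent to \<open>a\<close> modulo
    \<open>q\<close>, each exactly once.\<close>
  define \<iota> where "\<iota> d = scale_exp q d + r" for d :: "'n \<Rightarrow>\<^sub>0 nat"
  have \<iota>: "lookup (\<iota> d) i = q * lookup d i + lookup a i mod q" for d i
    by (simp add: \<iota>_def lookup_add r)
  have inj: "inj \<iota>"
  proof (rule injI, rule poly_mapping_eqI)
    fix d d' i assume "\<iota> d = \<iota> d'"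
    then have "lookup (\<iota> d) i = lookup (\<iota> d') i" by simp
    with \<open>q > 0\<close> show "lookup d i = lookup d' i" by (simp add: \<iota>)
  qed
  define T where "T g = Abs_poly_mapping (\<lambda>d. \<phi> (lookup g (\<iota> d)))" for g :: "('n, 'k) mpoly"
  have T: "lookup (T g) d = \<phi> (lookup g (\<iota> d))" for g d
  proof -
    have "finite (\<iota> -` keys g)" by (rule finite_vimageI[OF _ inj]) simp
    then have "finite {d. \<phi> (lookup g (\<iota> d)) \<noteq> 0}"
      by (rule rev_finite_subset) (auto simp: \<phi>0 in_keys_iff)
    then show ?thesis by (simp add: T_def)
  qed
  have T_add: "T (g + h) = T g + T h" for g h
    by (rule poly_mapping_eqI) (simp add: T lookup_add \<phi>(2))
  have T0: "T 0 = 0" by (rule poly_mapping_eqI) (simp add: T \<phi>0)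
  have T_sum: "T (sum g X) = (\<Sum>x\<in>X. T (g x))" for g and X :: "('n \<Rightarrow>\<^sub>0 nat) set"
    by (induction X rule: infinite_finite_induct) (simp_all add: T0 T_add)
  \<comment> \<open>Single terms suffice by additivity. A factor that is a \<open>q\<close>-th power
    does not change residues modulo \<open>q\<close>, so either both sides vanish or
    \<open>\<phi>\<close> pulls out \<open>v\<close>.\<close>
  have T_single: "T (Poly_Mapping.single x u * Poly_Mapping.single c v ^ q) =
      T (Poly_Mapping.single x u) * Poly_Mapping.single c v" for x c u v
  proof -
    have eq: "Poly_Mapping.single x u * Poly_Mapping.single c v ^ q =
        Poly_Mapping.single (x + scale_exp q c) (v ^ q * u)"
      by (simp add: single_power mult_single mult.commute)
    show ?thesis
    proof (cases "x \<in> range \<iota>")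
      case True
      then obtain d where d: "x = \<iota> d" by blast
      have T': "T (Poly_Mapping.single (\<iota> d) u) = Poly_Mapping.single d (\<phi> u)" for d u
        by (rule poly_mapping_eqI)
           (auto simp: T lookup_single when_def \<phi>0 inj_eq[OF inj])
      have "x + scale_exp q c = \<iota> (d + c)"
        by (simp add: d \<iota>_def scale_exp_add ac_simps)
      then show ?thesis unfolding eq by (simp add: T' \<phi>(3) d mult_single mult.commute[of v])
    next
      case False
      have "x + scale_exp q c \<noteq> \<iota> d" for d
      proof
        assume "x + scale_exp q c = \<iota> d"
        then have *: "lookup x i + q * lookup c i = q * lookup d i + lookup a i mod q" for i
          by (metis \<iota> lookup_add lookup_scale_exp)
        have "x = \<iota> (div_exp x q)"
        proof (rule poly_mapping_eqI)
          fix i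
          have "lookup x i mod q = lookup a i mod q"
            using arg_cong[OF *[of i], of "\<lambda>x. x mod q"] by simp
          then show "lookup x i = lookup (\<iota> (div_exp x q)) i"
            by (simp add: \<iota> flip: \<open>lookup x i mod q = lookup a i mod q\<close>)
        qed
        with False show False by blast
      qed
      moreover have "x \<noteq> \<iota> d" for d using False by blast
      ultimately have "T (Poly_Mapping.single (x + scale_exp q c) u) = 0"
        "T (Poly_Mapping.single x u) = 0" for u
        by (auto intro!: poly_mapping_eqI simp: T lookup_single when_def \<phi>0)
      then show ?thesis unfolding eq by simp
    qed
  qed
  have T_mult: "T (h * f ^ q) = T h * f" for h f
  proof -
    have fq: "f ^ q = (\<Sum>c\<in>keys f. Poly_Mapping.single c (lookup f c) ^ q)"
      by (subst poly_mapping_sum_single, rule freshmans_dream_sum') (use assms in \<open>auto simp: CHAR_mpoly\<close>)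
    have "T (h * f ^ q) =
        T ((\<Sum>x\<in>keys h. Poly_Mapping.single x (lookup h x)) *
           (\<Sum>c\<in>keys f. Poly_Mapping.single c (lookup f c) ^ q))"
      by (simp only: fq poly_mapping_sum_single[symmetric])
    also have "\<dots> = (\<Sum>x\<in>keys h. T (Poly_Mapping.single x (lookup h x))) *
        (\<Sum>c\<in>keys f. Poly_Mapping.single c (lookup f c))"
      by (simp add: sum_product T_sum T_single)
    also have "\<dots> = T h * f"
      by (simp only: poly_mapping_sum_single[symmetric] T_sum[symmetric])
    finally show ?thesis .
  qed
  \<comment> \<open>Quantifying over all \<open>h\<close> makes this set an ideal; it contains the
    generators \<open>f ^ q\<close> of the bracket power by \<open>T_mult\<close>.\<close>
  have "is_ideal {g. \<forall>h. T (h * g) \<in> L}"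
  proof (rule is_idealI)
    fix c g assume "g \<in> {g. \<forall>h. T (h * g) \<in> L}"
    then have "T (h * c * g) \<in> L" for h by blast
    then show "c * g \<in> {g. \<forall>h. T (h * g) \<in> L}" by (simp add: mult.assoc)
  qed (use L in \<open>auto simp: T0 T_add distrib_left intro: is_ideal_0 is_ideal_add\<close>)
  then have "frob_bracket L q \<subseteq> {g. \<forall>h. T (h * g) \<in> L}"
    unfolding frob_bracket_def
    by (intro ideal_gen_minimal) (auto simp: T_mult intro: is_ideal_mult[OF L])
  with a have "T (1 * monomial a) \<in> L" by blast
  moreover have "T (monomial a) = monomial (div_exp a q)"
  proof -
    have "a = \<iota> (div_exp a q)" by (rule poly_mapping_eqI) (simp add: \<iota>)
    then have "a = \<iota> d \<longleftrightarrow> div_exp a q = d" for d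
      using inj_eq[OF inj] by metis
    then show ?thesis
      by (intro poly_mapping_eqI) (auto simp: T monomial_def lookup_single when_def \<phi>(1) \<phi>0)
  qed
  ultimately show ?thesis by simp
qed

text \<open>Since \<open>q * (n div q) \<le> n\<close>, the bracket power of the ideal of rounded
  exponents contains the given ideal. Any other such ideal contains the rounded monomials by
  \<open>monomial_mem_frob_bracket\<close>.\<close>

lemma frob_root_monomial:
  fixes V :: "('n::finite \<Rightarrow>\<^sub>0 nat) set"
  assumes "prime CHAR('k)" and q: "q = CHAR('k::field) ^ e"
  shows "frob_root (ideal_gen (monomial ` V)) q =
    (ideal_gen (monomial ` (\<lambda>a. div_exp a q) ` V) :: ('n, 'k) mpoly set)"
  unfolding frob_root_def
proof (rule Least_equality)
  have "V + UNIV \<subseteq> scale_exp q ` (\<lambda>a. div_exp a q) ` V + UNIV"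
  proof
    fix c assume "c \<in> V + UNIV"
    then obtain a where a: "a \<in> V" "\<And>i. lookup a i \<le> lookup c i"
      unfolding mem_plus_UNIV_iff by blast
    have "lookup (scale_exp q (div_exp a q)) i \<le> lookup c i" for i
      using a(2)[of i] by (simp add: order_trans[OF times_div_less_eq_dividend])
    then show "c \<in> scale_exp q ` (\<lambda>a. div_exp a q) ` V + UNIV"
      unfolding mem_plus_UNIV_iff using a(1) by blast
  qed
  then show "is_ideal (ideal_gen (monomial ` (\<lambda>a. div_exp a q) ` V)) \<and> (ideal_gen (monomial ` V) ::
      ('n, 'k) mpoly set) \<subseteq> frob_bracket (ideal_gen (monomial ` (\<lambda>a. div_exp a q) ` V)) q"
    unfolding frob_bracket_monomial[OF assms] using is_ideal_ideal_gen
    by (auto simp: ideal_gen_monomial is_ideal_keys_subset)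
next
  fix L :: "('n, 'k) mpoly set"
  assume "is_ideal L \<and> ideal_gen (monomial ` V) \<subseteq> frob_bracket L q"
  then have L: "is_ideal L" "ideal_gen (monomial ` V) \<subseteq> frob_bracket L q" by auto
  show "ideal_gen (monomial ` (\<lambda>a. div_exp a q) ` V) \<subseteq> L"
  proof (rule ideal_gen_minimal[OF _ L(1)], safe)
    fix a assume "a \<in> V"
    then have "(monomial a :: ('n, 'k) mpoly) \<in> frob_bracket L q"
      using L(2) ideal_gen_base by blast
    then show "(monomial (div_exp a q) :: ('n, 'k) mpoly) \<in> L"
      by (rule monomial_mem_frob_bracket[OF assms L(1)])
  qed
qed

section \<open>Integral Frobenius powers and digit sums\<close>

text \<open>Horner form of the sums over base \<open>p\<close> digits; the guard
  \<open>p < 2\<close> ensures termination.\<close>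

function digit_sums :: "nat \<Rightarrow> ('n \<Rightarrow>\<^sub>0 nat) set \<Rightarrow> nat \<Rightarrow> ('n \<Rightarrow>\<^sub>0 nat) set" where
  "digit_sums p A k = (if k = 0 \<or> p < 2 then {0}
     else sumset_pow A (k mod p) + scale_exp p ` digit_sums p A (k div p))"
  by auto
termination by (relation "measure (\<lambda>(p, A, k). k)") auto

declare digit_sums.simps [simp del]

lemma digit_sums_0 [simp]: "digit_sums p A 0 = {0}"
  by (simp add: digit_sums.simps)

lemma digit_sums_rec:
  assumes "p \<ge> 2"
  shows "digit_sums p A k = sumset_pow A (k mod p) + scale_exp p ` digit_sums p A (k div p)"
  using assms by (cases "k = 0") (simp_all add: digit_sums.simps[of p A k])

lemma digit_sums_eq_foldr:
  assumes "p \<ge> 2" "k < p ^ N"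
  shows "foldr (+) (map (\<lambda>i. scale_exp (p ^ i) ` sumset_pow A (k div p ^ i mod p)) [0..<N]) {0} =
    digit_sums p A k"
  using assms(2)
proof (induction N arbitrary: k)
  case (Suc N)
  have scale_foldr: "scale_exp p ` foldr (+) Xs {0} = foldr (+) (map ((`) (scale_exp p)) Xs) {0}"
    for Xs :: "('a \<Rightarrow>\<^sub>0 nat) set list"
  proof (induction Xs)
    case (Cons X Xs)
    have "scale_exp p ` (X + Y) = scale_exp p ` X + scale_exp p ` Y" for Y :: "('a \<Rightarrow>\<^sub>0 nat) set"
      by (force simp: set_plus_def scale_exp_add)
    with Cons show ?case by simp
  qed simp
  have "k div p < p ^ N"
    using Suc.prems by (simp add: less_mult_imp_div_less mult.commute)
  note IH = Suc.IH[OF this]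
  have "foldr (+) (map (\<lambda>i. scale_exp (p ^ i) ` sumset_pow A (k div p ^ i mod p)) [Suc 0..<Suc N]) {0} =
      scale_exp p ` digit_sums p A (k div p)"
    unfolding IH[symmetric] scale_foldr map_Suc_upt[symmetric]
    by (simp add: o_def image_image scale_exp_scale_exp div_mult2_eq)
  then show ?case
    by (subst upt_conv_Cons) (simp_all add: digit_sums_rec[OF assms(1), of A k] del: upt_Suc)
qed simp

lemma frob_pow_nat_monomial:
  fixes A :: "('n::finite \<Rightarrow>\<^sub>0 nat) set"
  assumes "prime p" and p: "p = CHAR('k::field)"
  shows "frob_pow_nat p (ideal_gen (monomial ` A)) k =
    (ideal_gen (monomial ` digit_sums p A k) :: ('n, 'k) mpoly set)"
proof -
  have "p \<ge> 2" using assms by (simp add: prime_ge_2_nat)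
  have foldr_ideal: "foldr ideal_mult (map (\<lambda>i. ideal_gen (monomial ` X i)) is) UNIV =
      (ideal_gen (monomial ` foldr (+) (map X is) {0}) :: ('n, 'k) mpoly set)"
    for X and "is" :: "nat list"
    by (induction "is") (simp_all add: ideal_mult_monomial flip: ideal_gen_monomial_0 del: image_insert)
  have "k < p ^ Suc k"
    using \<open>p \<ge> 2\<close> by (metis less_exp less_le_trans lessI less_trans power_mono zero_le)
  then show ?thesis
    using assms \<open>p \<ge> 2\<close>
    by (simp add: frob_pow_nat_def ideal_pow_monomial frob_bracket_monomial[where e = i for i]
        foldr_ideal digit_sums_eq_foldr del: upt_Suc)
qed

text \<open>Strict, because \<open>a div q \<le> b\<close> is equivalent to
  \<open>a < q * (b + 1)\<close>; so for \<open>M = b + 1\<close> this is membership of the monomial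
  in the Frobenius power with exponent \<open>k / p ^ e\<close>.\<close>

definition fits :: "nat \<Rightarrow> ('n \<Rightarrow>\<^sub>0 nat) set \<Rightarrow> nat \<Rightarrow> nat \<Rightarrow> ('n \<Rightarrow> nat) \<Rightarrow> bool" where
  "fits p A k e M \<longleftrightarrow> (\<exists>a\<in>digit_sums p A k. \<forall>i. lookup a i < p ^ e * M i)"

lemma frob_pow_frac_monomial:
  fixes A :: "('n::finite \<Rightarrow>\<^sub>0 nat) set"
  assumes "prime p" and p: "p = CHAR('k::field)"
  shows "frob_pow_frac p (ideal_gen (monomial ` A)) k (p ^ e) =
    {f :: ('n, 'k) mpoly. \<forall>b\<in>keys f. fits p A k e (\<lambda>i. lookup b i + 1)}"
proof -
  have "p > 0" using assms by (simp add: prime_gt_0_nat)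
  then have "m div p ^ e \<le> n \<longleftrightarrow> m < p ^ e * (n + 1)" for m n
    by (metis Suc_eq_plus1 div_less_iff_less_mult less_Suc_eq_le mult.commute zero_less_power)
  then have "b \<in> (\<lambda>a. div_exp a (p ^ e)) ` digit_sums p A k + UNIV \<longleftrightarrow>
      fits p A k e (\<lambda>i. lookup b i + 1)" for b :: "'n \<Rightarrow>\<^sub>0 nat"
    by (simp add: mem_plus_UNIV_iff fits_def)
  then show ?thesis
    unfolding frob_pow_frac_def frob_pow_nat_monomial[OF assms]
    using assms frob_root_monomial[of "p ^ e" e "digit_sums p A k", where 'k = 'k]
    by (auto simp: ideal_gen_monomial)
qed

lemma scale_exp_mem_sumset_pow: "c \<in> A \<Longrightarrow> scale_exp n c \<in> sumset_pow A n"
  by (induction n) (auto simp: scale_exp_Suc)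

lemma finite_sumset_pow: "finite A \<Longrightarrow> finite (sumset_pow A n)"
  by (induction n) (auto intro: finite_set_plus)

lemma sumset_pow_lookup_le:
  assumes "\<And>c i. c \<in> A \<Longrightarrow> lookup c i \<le> D" "a \<in> sumset_pow A n"
  shows "lookup a i \<le> n * D"
  using assms(2)
proof (induction n arbitrary: a)
  case (Suc n)
  then show ?case using assms(1) by (force elim!: set_plus_elim simp: lookup_add intro: add_mono)
qed simp

text \<open>A nonzero exponent vector has total degree at least 1. This bound is what makes
  thresholds finite.\<close>

lemma le_sum_lookup_sumset_pow:
  fixes A :: "('n::finite \<Rightarrow>\<^sub>0 nat) set"
  assumes "0 \<notin> A" "a \<in> sumset_pow A n"
  shows "n \<le> (\<Sum>i\<in>UNIV. lookup a i)"
  using assms(2)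
proof (induction n arbitrary: a)
  case (Suc n)
  then obtain c s where a: "a = c + s" and c: "c \<in> A" and s: "s \<in> sumset_pow A n"
    by (auto elim: set_plus_elim)
  have "c \<noteq> 0" using c assms(1) by auto
  then obtain i where "lookup c i \<noteq> 0" by (metis lookup_zero poly_mapping_eqI)
  then have "1 \<le> (\<Sum>i\<in>UNIV. lookup c i)"
    by (metis UNIV_I finite_class.finite_UNIV less_one not_le sum_eq_0_iff)
  with Suc.IH[OF s] show ?case by (simp add: a lookup_add sum.distrib)
qed simp

section \<open>Combinatorics of digit sums\<close>

locale frobenius_exponents =
  fixes p :: nat and A :: "('n::finite \<Rightarrow>\<^sub>0 nat) set"
  assumes p: "p \<ge> 2" and finite: "finite A" and nonempty: "A \<noteq> {}" and zero: "0 \<notin> A"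
begin

lemma digit_sums_mult_add:
  assumes "d < p"
  shows "digit_sums p A (p * k + d) = sumset_pow A d + scale_exp p ` digit_sums p A k"
  using assms p by (subst digit_sums_rec) auto

lemma finite_digit_sums: "finite (digit_sums p A k)"
proof (induction k rule: less_induct)
  case (less k)
  show ?case
  proof (cases "k = 0")
    case False
    with p less show ?thesis
      by (subst digit_sums_rec) (auto intro!: finite_set_plus finite_sumset_pow finite)
  qed simp
qed

text \<open>The base \<open>p\<close> expansion of \<open>p ^ e * n + r\<close> is that of
  \<open>n\<close> followed by the \<open>e\<close> digits of \<open>r\<close>, without
  carries.\<close>

lemma digit_sums_power_add:
  assumes "r < p ^ e"
  shows "digit_sums p A (p ^ e * n + r) = scale_exp (p ^ e) ` digit_sums p A n + digit_sums p A r"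
  using assms
proof (induction e arbitrary: r)
  case 0
  then show ?case by simp
next
  case (Suc e)
  have r: "r div p < p ^ e"
    using Suc.prems by (simp add: less_mult_imp_div_less mult.commute)
  have rd: "r mod p < p" using p by simp
  have scale_plus: "scale_exp p ` (X + Y) = scale_exp p ` X + scale_exp p ` Y"
    for X Y :: "('n \<Rightarrow>\<^sub>0 nat) set"
    by (force simp: set_plus_def scale_exp_add)
  have "p ^ Suc e * n + r = p * (p ^ e * n + r div p) + r mod p"
    by (simp add: algebra_simps)
  then have "digit_sums p A (p ^ Suc e * n + r) =
      sumset_pow A (r mod p) + scale_exp p ` digit_sums p A (p ^ e * n + r div p)"
    using digit_sums_mult_add[OF rd] by metis
  also have "\<dots> = scale_exp (p ^ Suc e) ` digit_sums p A n +
      (sumset_pow A (r mod p) + scale_exp p ` digit_sums p A (r div p))"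
    unfolding Suc.IH[OF r] scale_plus by (simp add: image_image scale_exp_scale_exp ac_simps)
  also have "sumset_pow A (r mod p) + scale_exp p ` digit_sums p A (r div p) = digit_sums p A r"
    using p by (rule digit_sums_rec[symmetric])
  finally show ?case .
qed

lemma digit_sums_power_mult: "digit_sums p A (p ^ e * n) = scale_exp (p ^ e) ` digit_sums p A n"
  using digit_sums_power_add[of 0 e n] p by simp

lemma digit_sums_1: "digit_sums p A 1 = A" "digit_sums p A (Suc 0) = A"
  using digit_sums_mult_add[of 1 0] p by simp_all

lemma plus_mem_digit_sums_Suc:
  assumes "\<not> p dvd Suc n" "a \<in> digit_sums p A n" "c \<in> A"
  shows "a + c \<in> digit_sums p A (Suc n)"
proof -
  have "Suc n mod p \<noteq> 0" using assms(1) by (meson mod_0_imp_dvd)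
  then have "Suc n mod p = Suc (n mod p)" "Suc n div p = n div p"
    by (auto simp: mod_Suc div_Suc split: if_splits)
  then have "digit_sums p A (Suc n) = A + digit_sums p A n"
    using digit_sums_rec[OF p] by (metis add.assoc sumset_pow.simps(2))
  with assms show ?thesis by (metis add.commute set_plus_intro)
qed

text \<open>Lowering the exponent by 1 must free an element of \<open>A\<close>. If the lowest digit
  of \<open>Suc k\<close> is positive, drop a summand. If it is 0, apply the claim to
  \<open>Suc k div p\<close>; of the \<open>p\<close> copies of the element freed there,
  \<open>p - 1\<close> fill the new lowest digit and one remains.\<close>

lemma digit_sums_Suc_dominates:
  assumes "a \<in> digit_sums p A (Suc k)"
  shows "\<exists>a'\<in>digit_sums p A k. \<exists>c\<in>A. \<forall>i. lookup a' i + lookup c i \<le> lookup a i"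
  using assms
proof (induction k arbitrary: a rule: less_induct)
  case (less k)
  show ?case
  proof (cases "p dvd Suc k")
    case False
    then have "Suc k mod p \<noteq> 0" by (meson mod_0_imp_dvd)
    then have *: "Suc k mod p = Suc (k mod p)" "Suc k div p = k div p"
      by (auto simp: mod_Suc div_Suc split: if_splits)
    have "digit_sums p A (Suc k) = A + digit_sums p A k"
      using digit_sums_rec[OF p] * by (metis add.assoc sumset_pow.simps(2))
    with less.prems obtain c a' where "c \<in> A" "a' \<in> digit_sums p A k" "a = c + a'"
      by (auto elim: set_plus_elim)
    then show ?thesis by (intro bexI[of _ a'] bexI[of _ c]) (auto simp: lookup_add)
  next
    case True
    then obtain m where "Suc k = p * m" by blast
    then obtain n where n: "Suc k = p * Suc n" by (cases m) auto
    with p have "n < k" by (cases p) auto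
    obtain a1 where a1: "a1 \<in> digit_sums p A (Suc n)" "a = scale_exp p a1"
      using less.prems digit_sums_power_mult[of 1 "Suc n"] n by auto
    obtain a2 c where a2: "a2 \<in> digit_sums p A n" "c \<in> A"
        "\<And>i. lookup a2 i + lookup c i \<le> lookup a1 i"
      using less.IH[OF \<open>n < k\<close> a1(1)] by blast
    have k: "k = p * n + (p - 1)" using n p by simp
    have "scale_exp (p - 1) c + scale_exp p a2 \<in> digit_sums p A k"
      unfolding k using p a2 by (subst digit_sums_mult_add) (auto intro: scale_exp_mem_sumset_pow)
    moreover have "lookup (scale_exp (p - 1) c + scale_exp p a2) i + lookup c i \<le> lookup a i" for i
    proof -
      have "lookup (scale_exp (p - 1) c + scale_exp p a2) i + lookup c i =
          p * (lookup a2 i + lookup c i)"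
        using p by (cases p) (simp_all add: lookup_add algebra_simps)
      also have "\<dots> \<le> lookup a i" using a2(3)[of i] by (simp add: a1(2))
      finally show ?thesis .
    qed
    ultimately show ?thesis using a2(2) by blast
  qed
qed

lemma le_sum_lookup_digit_sums:
  "a \<in> digit_sums p A k \<Longrightarrow> k \<le> (\<Sum>i\<in>UNIV. lookup a i)"
proof (induction k arbitrary: a rule: less_induct)
  case (less k)
  show ?case
  proof (cases "k = 0")
    case False
    obtain s a1 where a: "a = s + scale_exp p a1" and s: "s \<in> sumset_pow A (k mod p)"
        and a1: "a1 \<in> digit_sums p A (k div p)"
      using less.prems digit_sums_rec[OF p, of A k] by (auto elim!: set_plus_elim)
    have "k div p \<le> (\<Sum>i\<in>UNIV. lookup a1 i)"
      using a1 False p by (intro less.IH) auto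
    then have "k mod p + p * (k div p) \<le> (\<Sum>i\<in>UNIV. lookup s i) + p * (\<Sum>i\<in>UNIV. lookup a1 i)"
      using le_sum_lookup_sumset_pow[OF zero s] by (intro add_mono mult_left_mono) auto
    then show ?thesis by (simp add: a lookup_add sum.distrib sum_distrib_left)
  qed simp
qed

text \<open>For bounded \<open>k / p ^ e\<close> this bounds the exponents after division by
  \<open>p ^ e\<close>, which leaves finitely many generators.\<close>

lemma digit_sums_lookup_le:
  assumes "\<And>c i. c \<in> A \<Longrightarrow> lookup c i \<le> D"
  shows "a \<in> digit_sums p A k \<Longrightarrow> lookup a i \<le> k * D"
proof (induction k arbitrary: a rule: less_induct)
  case (less k)
  show ?case
  proof (cases "k = 0")
    case False
    obtain s a1 where a: "a = s + scale_exp p a1" and s: "s \<in> sumset_pow A (k mod p)"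
        and a1: "a1 \<in> digit_sums p A (k div p)"
      using less.prems digit_sums_rec[OF p, of A k] by (auto elim!: set_plus_elim)
    have "lookup a1 i \<le> k div p * D"
      using a1 False p by (intro less.IH) auto
    then have "lookup s i + p * lookup a1 i \<le> k mod p * D + p * (k div p * D)"
      using sumset_pow_lookup_le[OF assms s] by (intro add_mono mult_left_mono) auto
    also have "\<dots> = (k mod p + p * (k div p)) * D" by (simp only: algebra_simps)
    finally show ?thesis by (simp add: a lookup_add)
  qed (use less in simp)
qed

lemma fits_mono_exponent:
  assumes "fits p A k e M" "k' \<le> k"
  shows "fits p A k' e M"
  using assms(2,1)
proof (induction k' rule: inc_induct)
  case (step n)
  then obtain a where "a \<in> digit_sums p A (Suc n)" "\<And>i. lookup a i < p ^ e * M i"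
    by (auto simp: fits_def)
  with digit_sums_Suc_dominates[of a n] show ?case
    unfolding fits_def by (meson add_leD1 order_le_less_trans)
qed

lemma fits_mono:
  assumes "fits p A k e M" "\<And>i. M i \<le> N i"
  shows "fits p A k e N"
  using assms unfolding fits_def by (meson mult_le_mono2 order_less_le_trans)

text \<open>Only the value of \<open>k / p ^ e\<close> matters, so fractions may be brought to a
  common denominator.\<close>

lemma fits_power_iff: "fits p A (p ^ s * k) (s + e) M \<longleftrightarrow> fits p A k e M"
  using p by (simp add: fits_def digit_sums_power_mult power_add mult.assoc)

lemma fits_scale_iff: "fits p A k e (\<lambda>i. p * M i) \<longleftrightarrow> fits p A k (Suc e) M"
  by (simp add: fits_def ac_simps)

lemma fits_bound:
  assumes "fits p A k e M"
  shows "k \<le> p ^ e * (\<Sum>i\<in>UNIV. M i)"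
proof -
  obtain a where a: "a \<in> digit_sums p A k" "\<And>i. lookup a i < p ^ e * M i"
    using assms by (auto simp: fits_def)
  have "k \<le> (\<Sum>i\<in>UNIV. lookup a i)" using a(1) by (rule le_sum_lookup_digit_sums)
  also have "\<dots> \<le> (\<Sum>i\<in>UNIV. p ^ e * M i)" using a(2) by (intro sum_mono less_imp_le)
  finally show ?thesis by (simp add: sum_distrib_left)
qed

text \<open>The strict inequality leaves a gap of at least 1, which scaling by \<open>p ^ s\<close>
  widens enough for a further element of \<open>A\<close>. So no fitting fraction is the largest
  one.\<close>

lemma fits_refine:
  assumes "fits p A k e M"
  obtains s where "fits p A (p ^ s * k + 1) (s + e) M"
proof -
  obtain a where a: "a \<in> digit_sums p A k" "\<And>i. lookup a i < p ^ e * M i"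
    using assms by (auto simp: fits_def)
  obtain c where c: "c \<in> A" using nonempty by blast
  \<comment> \<open>\<open>p ^ s\<close> exceeds every component of \<open>c\<close>; the
    \<open>Suc\<close> gives \<open>1 < p ^ s\<close>, so that \<open>p ^ s * k + 1\<close> involves
    no carry.\<close>
  define s where "s = Suc (\<Sum>i\<in>UNIV. lookup c i)"
  have "s < p ^ s" using p by (intro power_gt_expt) simp
  have "lookup c i < p ^ s" for i
    using member_le_sum[of i UNIV "lookup c"] \<open>s < p ^ s\<close> by (simp add: s_def)
  then have "p ^ s * lookup a i + lookup c i < p ^ (s + e) * M i" for i
  proof -
    have "p ^ s * lookup a i + lookup c i < p ^ s * (lookup a i + 1)"
      using \<open>lookup c i < p ^ s\<close> by simp
    also have "\<dots> \<le> p ^ s * (p ^ e * M i)"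
      using a(2)[of i] by (intro mult_le_mono2) simp
    finally show ?thesis by (simp add: power_add mult.assoc)
  qed
  moreover have "scale_exp (p ^ s) a + c \<in> digit_sums p A (p ^ s * k + 1)"
    using \<open>s < p ^ s\<close> a(1) c by (subst digit_sums_power_add) (auto simp: s_def digit_sums_1)
  ultimately have "fits p A (p ^ s * k + 1) (s + e) M"
    unfolding fits_def by (intro bexI[of _ "scale_exp (p ^ s) a + c"]) (auto simp: lookup_add)
  then show ?thesis by (rule that)
qed

section \<open>Thresholds\<close>

definition threshold :: "('n \<Rightarrow> nat) \<Rightarrow> real" where
  "threshold M = Sup {real k / real p ^ e | k e. fits p A k e M}"

lemma p_pos [simp]: "0 < p" "0 < real p"
  using p by auto

text \<open>The fitting fractions are closed downwards by \<open>fits_mono_exponent\<close> and have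
  no maximum by \<open>fits_refine\<close>; hence the strict inequality.\<close>

lemma fits_iff_threshold:
  assumes "\<And>i. M i > 0"
  shows "fits p A k e M \<longleftrightarrow> real k < real p ^ e * threshold M"
proof
  let ?S = "{real k / real p ^ e | k e. fits p A k e M}"
  have "x \<le> real (\<Sum>i\<in>UNIV. M i)" if x: "x \<in> ?S" for x
  proof -
    obtain k e where x: "x = real k / real p ^ e" and "fits p A k e M" using x by blast
    then have "real k \<le> real (p ^ e * (\<Sum>i\<in>UNIV. M i))" using fits_bound of_nat_mono by blast
    then show ?thesis by (simp add: x divide_le_eq mult.commute)
  qed
  then have bdd: "bdd_above ?S" by (meson bdd_aboveI)
  { assume "fits p A k e M"
    then obtain s where s: "fits p A (p ^ s * k + 1) (s + e) M" by (rule fits_refine)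
    have "real k / real p ^ e < real (p ^ s * k + 1) / real p ^ (s + e)"
      by (simp add: divide_less_eq power_add field_simps)
    also have "\<dots> \<le> threshold M"
      unfolding threshold_def using s by (intro cSup_upper bdd) blast
    finally show "real k < real p ^ e * threshold M"
      by (simp add: divide_less_eq mult.commute) }
  { assume "real k < real p ^ e * threshold M"
    then have "real k / real p ^ e < Sup ?S"
      by (simp add: divide_less_eq mult.commute flip: threshold_def)
    moreover have "fits p A 0 0 M" using assms by (simp add: fits_def)
    then have "?S \<noteq> {}" by blast
    ultimately obtain k' e' where *: "real k / real p ^ e < real k' / real p ^ e'"
        "fits p A k' e' M"
      using less_cSupD[of ?S] by blast
    then have "real (p ^ e' * k) < real (p ^ e * k')" by (simp add: field_simps)
    then have "p ^ e' * k \<le> p ^ e * k'" by linarith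
    moreover have "fits p A (p ^ e * k') (e' + e) M"
      using *(2) fits_power_iff[of e k' e' M] by (simp add: add.commute)
    ultimately have "fits p A (p ^ e' * k) (e' + e) M" by (rule fits_mono_exponent[rotated])
    then show "fits p A k e M" by (simp add: fits_power_iff) }
qed

text \<open>Nonnegative reals are determined by the fractions \<open>k / p ^ e\<close> below them,
  so thresholds can be compared through \<open>fits\<close>.\<close>

lemma le_by_p_adic_approximation:
  assumes "v \<ge> 0" "\<And>k e. real k < real p ^ e * u \<Longrightarrow> real k < real p ^ e * v"
  shows "u \<le> v"
proof (rule ccontr)
  assume "\<not> u \<le> v"
  then have uv: "0 < u - v" by simp
  obtain e where e: "1 / (u - v) < real p ^ e"
    using real_arch_pow[of "real p"] p by auto
  \<comment> \<open>The least natural number above \<open>real p ^ e * v\<close>; the choice of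
    \<open>e\<close> keeps it below \<open>real p ^ e * u\<close>.\<close>
  define k where "k = nat \<lfloor>real p ^ e * v\<rfloor> + 1"
  have "0 \<le> real p ^ e * v" using assms(1) by simp
  then have k: "real p ^ e * v < real k" "real k \<le> real p ^ e * v + 1"
    unfolding k_def by linarith+
  have "1 < real p ^ e * (u - v)" using e uv by (simp add: divide_less_eq)
  then have "real k < real p ^ e * u" using k(2) by (simp add: right_diff_distrib)
  then have "real k < real p ^ e * v" by (rule assms(2))
  with k(1) show False by simp
qed

lemma threshold_pos:
  assumes "\<And>i. M i > 0"
  shows "threshold M > 0"
proof -
  have "fits p A 0 0 M" using assms by (simp add: fits_def)
  then show ?thesis using fits_iff_threshold[OF assms] by simp
qed

lemma threshold_mono:
  assumes "\<And>i. M i > 0" "\<And>i. M i \<le> N i"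
  shows "threshold M \<le> threshold N"
proof (rule le_by_p_adic_approximation)
  have N: "N i > 0" for i using assms by (meson order_less_le_trans)
  show "threshold N \<ge> 0" using threshold_pos[of N, OF N] by simp
  show "real k < real p ^ e * threshold N" if "real k < real p ^ e * threshold M" for k e
    proof -
    have "fits p A k e M" using that fits_iff_threshold[of M, OF assms(1)] by blast
    then have "fits p A k e N" using assms(2) by (rule fits_mono)
    then show ?thesis using fits_iff_threshold[of N, OF N] by blast
  qed
qed

lemma threshold_scale:
  assumes "\<And>i. M i > 0"
  shows "threshold (\<lambda>i. p * M i) = real p * threshold M"
proof -
  define N where "N = (\<lambda>i. p * M i)"
  have N: "N i > 0" for i using assms by (simp add: N_def)
  have iff: "real k < real p ^ e * threshold N \<longleftrightarrow> real k < real p ^ e * (real p * threshold M)"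
    for k e
  proof -
    have "real k < real p ^ e * threshold N \<longleftrightarrow> fits p A k e N"
      by (rule fits_iff_threshold[of N, OF N, symmetric])
    also have "\<dots> \<longleftrightarrow> fits p A k (Suc e) M"
      unfolding N_def by (rule fits_scale_iff)
    also have "\<dots> \<longleftrightarrow> real k < real p ^ Suc e * threshold M"
      by (rule fits_iff_threshold[of M, OF assms])
    finally show ?thesis by (simp only: power_Suc2 mult.assoc)
  qed
  have "threshold N = real p * threshold M"
  proof (rule antisym; rule le_by_p_adic_approximation)
    show "0 \<le> real p * threshold M" using threshold_pos[of M, OF assms] by simp
    show "0 \<le> threshold N" using threshold_pos[of N, OF N] by simp
  qed (simp_all only: iff)
  then show ?thesis by (simp only: N_def)
qed

section \<open>Fractional parts of thresholds\<close>

lemma exists_threshold_frac_of_no_carry: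
  assumes M: "\<And>i. M i > 0" and t: "threshold M = real n + f" and f: "0 < f" "f \<le> 1"
    and no_carry: "f < 1 \<or> \<not> p dvd Suc n"
  shows "\<exists>N. (\<forall>i. N i > 0) \<and> threshold N = f"
proof -
  \<comment> \<open>The largest natural number below \<open>real p ^ e * f\<close>: the first
    \<open>e\<close> digits of the nonterminating expansion of \<open>f\<close>. As
    \<open>f \<le> 1\<close>, it is less than \<open>p ^ e\<close>.\<close>
  define r where "r e = nat (\<lceil>real p ^ e * f\<rceil> - 1)" for e
  have r: "real (r e) < real p ^ e * f" "real p ^ e * f \<le> real (r e) + 1" for e
  proof -
    have "0 < real p ^ e * f" using f by simp
    then show "real (r e) < real p ^ e * f" "real p ^ e * f \<le> real (r e) + 1"
      unfolding r_def by linarith+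
  qed
  have r_less: "r e < p ^ e" for e
  proof -
    have "real p ^ e * f \<le> real p ^ e" using f by (simp add: mult_left_le)
    with r(1)[of e] have "real (r e) < real p ^ e" by (rule less_le_trans)
    then show ?thesis by (simp only: of_nat_less_iff flip: of_nat_power)
  qed
  \<comment> \<open>The candidate \<open>a\<close> for the integer part, scaled by
    \<open>p ^ e\<close>, leaves room below \<open>p ^ e * M\<close> for a sum for
    \<open>r e\<close>.\<close>
  define P where "P a e \<longleftrightarrow>
    (\<exists>a'\<in>digit_sums p A (r e). \<forall>i. p ^ e * lookup a i + lookup a' i < p ^ e * M i)" for a e
  have "\<exists>a\<in>digit_sums p A n. P a e" for e
  proof -
    have "real (p ^ e * n + r e) < real p ^ e * threshold M"
      using r(1)[of e] by (simp add: t distrib_left)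
    then have "fits p A (p ^ e * n + r e) e M"
      using fits_iff_threshold[of M, OF M] by blast
    then obtain x where "x \<in> digit_sums p A (p ^ e * n + r e)" "\<And>i. lookup x i < p ^ e * M i"
      unfolding fits_def by blast
    moreover from this(1) obtain a a' where "a \<in> digit_sums p A n" "a' \<in> digit_sums p A (r e)"
        "x = scale_exp (p ^ e) a + a'"
      unfolding digit_sums_power_add[OF r_less] by (auto elim: set_plus_elim)
    ultimately show ?thesis unfolding P_def by (auto simp: lookup_add)
  qed
  \<comment> \<open>Pigeonhole: one of finitely many \<open>a\<close> serves infinitely many
    \<open>e\<close>.\<close>
  then have "UNIV = (\<Union>a\<in>digit_sums p A n. {e. P a e})" by blast
  then have "\<exists>a\<in>digit_sums p A n. infinite {e. P a e}"
    using finite_digit_sums[of n] by (metis finite_UN infinite_UNIV_nat)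
  then obtain a where a: "a \<in> digit_sums p A n" "infinite {e. P a e}" by blast
  \<comment> \<open>The truncated subtraction is exact, since \<open>P a e\<close> holds for some
    \<open>e\<close> and forces \<open>a\<close> below \<open>M\<close>.\<close>
  define N where "N i = M i - lookup a i" for i
  have P_less: "lookup a i < M i" if "P a e" for e i
  proof -
    have "p ^ e * lookup a i < p ^ e * M i"
      using that unfolding P_def by (meson add_lessD1)
    then show ?thesis by simp
  qed
  have N: "N i > 0" for i
    using P_less a(2) unfolding N_def by (metis finite.emptyI empty_Collect_eq zero_less_diff)
  have MN: "M i = lookup a i + N i" for i
    using N[of i] by (simp add: N_def)
  have fitsN: "fits p A (r e) e N" if "P a e" for e
    using that unfolding P_def fits_def by (auto simp: MN distrib_left)
  have "f \<le> threshold N"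
  proof (rule le_by_p_adic_approximation)
    show "0 \<le> threshold N" using threshold_pos[of N, OF N] by simp
  next
    fix k e assume k: "real k < real p ^ e * f"
    obtain e' where e': "e \<le> e'" "P a e'"
      using a(2) by (auto simp: finite_nat_set_iff_bounded not_less)
    have "real (p ^ (e' - e) * k) < real p ^ (e' - e) * (real p ^ e * f)"
      using k by simp
    also have "\<dots> = real p ^ e' * f" using e'(1) by (simp flip: power_add mult.assoc)
    also have "\<dots> \<le> real (r e') + 1" by (rule r)
    finally have "p ^ (e' - e) * k \<le> r e'" by linarith
    with fitsN[OF e'(2)] have "fits p A (p ^ (e' - e) * k) (e' - e + e) N"
      using e'(1) by (auto intro: fits_mono_exponent)
    then have "fits p A k e N" by (simp only: fits_power_iff)
    then show "real k < real p ^ e * threshold N"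
      using fits_iff_threshold[of N, OF N] by blast
  qed
  \<comment> \<open>Otherwise a fraction that is too large fits below \<open>N\<close>; with
    \<open>a\<close> put back, \<open>M\<close> would exceed its own threshold.\<close>
  moreover have "threshold N \<le> f"
  proof (rule ccontr)
    assume gt: "\<not> threshold N \<le> f"
    show False
    proof (cases "f < 1")
      case True
      \<comment> \<open>The minimum with 1 keeps \<open>k < p ^ e\<close>, so that the digits of
        \<open>k\<close> follow those of \<open>n\<close> without a carry.\<close>
      then have "\<not> min 1 (threshold N) \<le> f" using gt by simp
      then obtain k e where k: "real k < real p ^ e * min 1 (threshold N)"
          "\<not> real k < real p ^ e * f"
        using le_by_p_adic_approximation[of f "min 1 (threshold N)"] f(1) by auto
      have "real p ^ e * min 1 (threshold N) \<le> real p ^ e * 1"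
          "real p ^ e * min 1 (threshold N) \<le> real p ^ e * threshold N"
        by (intro mult_left_mono; simp)+
      with k(1) have k': "real k < real p ^ e" "real k < real p ^ e * threshold N" by linarith+
      then have "fits p A k e N" using fits_iff_threshold[of N, OF N] by blast
      then obtain x where x: "x \<in> digit_sums p A k" "\<And>i. lookup x i < p ^ e * N i"
        unfolding fits_def by blast
      have "k < p ^ e" using k'(1) by (simp only: of_nat_less_iff flip: of_nat_power)
      then have "scale_exp (p ^ e) a + x \<in> digit_sums p A (p ^ e * n + k)"
        using a(1) x(1) by (auto simp: digit_sums_power_add)
      then have "fits p A (p ^ e * n + k) e M"
        unfolding fits_def using x(2) by (force simp: MN lookup_add distrib_left)
      then have "real (p ^ e * n + k) < real p ^ e * threshold M"
        using fits_iff_threshold[of M, OF M] by blast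
      with k(2) show False by (simp add: t distrib_left)
    next
      case False
      \<comment> \<open>Here the excess fraction is 1 itself, given by a single element of
        \<open>A\<close>; adding it to \<open>a\<close> is the step that a carry would
        break.\<close>
      with f have "f = 1" by simp
      then have "fits p A 1 0 N"
        using gt fits_iff_threshold[of N, OF N] by simp
      then obtain c where c: "c \<in> A" "\<And>i. lookup c i < N i"
        unfolding fits_def by (auto simp: digit_sums_1)
      have "a + c \<in> digit_sums p A (Suc n)"
        using no_carry False a(1) c(1) by (intro plus_mem_digit_sums_Suc) auto
      then have "fits p A (Suc n) 0 M"
        unfolding fits_def using c(2) by (force simp: MN lookup_add)
      then show False
        using fits_iff_threshold[of M "Suc n" 0, OF M] by (simp add: t \<open>f = 1\<close>)
    qed
  qed
  ultimately show ?thesis using N by (intro exI[of _ N]) auto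
qed

text \<open>Take \<open>N\<close> as \<open>M / p\<close> rounded up. Then
  \<open>M \<le> p * N\<close> bounds \<open>threshold N\<close> from below. From above, a sum for
  \<open>m\<close> that fits below \<open>N\<close> would fit below \<open>M\<close> after scaling
  by \<open>p\<close>.\<close>

lemma exists_threshold_div:
  assumes M: "\<And>i. M i > 0" and t: "threshold M = real (p * m)"
  shows "\<exists>N. (\<forall>i. N i > 0) \<and> threshold N = real m"
proof -
  define N where "N i = (M i + p - 1) div p" for i
  have N_iff: "x < N i \<longleftrightarrow> p * x < M i" for x i
  proof -
    have "x < N i \<longleftrightarrow> Suc x * p \<le> M i + p - 1"
      unfolding N_def Suc_le_eq[symmetric] by (rule less_eq_div_iff_mult_less_eq[OF p_pos(1)])
    also have "\<dots> \<longleftrightarrow> p * x < M i" using M[of i] p_pos(1) by (auto simp: mult.commute)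
    finally show ?thesis .
  qed
  have N: "N i > 0" for i using M by (simp add: N_iff)
  have "M i \<le> p * N i" for i
    using N_iff[of "N i" i] by simp
  then have "threshold M \<le> threshold (\<lambda>i. p * N i)"
    by (intro threshold_mono M)
  then have "real m \<le> threshold N"
    using threshold_scale[of N, OF N] by (simp add: t)
  moreover have "\<not> real m < threshold N"
  proof
    assume "real m < threshold N"
    then have "fits p A m 0 N" using fits_iff_threshold[of N m 0, OF N] by simp
    then obtain a where a: "a \<in> digit_sums p A m" "\<And>i. lookup a i < N i"
      unfolding fits_def by auto
    then have "scale_exp p a \<in> digit_sums p A (p * m)"
      using digit_sums_power_mult[of 1 m] by simp
    moreover have "lookup (scale_exp p a) i < M i" for i using a(2)[of i] by (simp add: N_iff)
    ultimately have "fits p A (p * m) 0 M"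
      unfolding fits_def by (intro bexI[of _ "scale_exp p a"]) simp_all
    then show False using fits_iff_threshold[of M "p * m" 0, OF M] by (simp add: t)
  qed
  ultimately show ?thesis using N by (intro exI[of _ N]) auto
qed

text \<open>Induction on the ceiling: in the carry case the threshold is a multiple of
  \<open>p\<close> and is replaced by its quotient. Both are positive integers and so have
  fractional part 1.\<close>

lemma exists_threshold_frac:
  assumes "\<And>i. M i > 0"
  shows "\<exists>N. (\<forall>i. N i > 0) \<and>
    threshold N = threshold M - real_of_int \<lceil>threshold M\<rceil> + 1"
  using assms
proof (induction "nat \<lceil>threshold M\<rceil>" arbitrary: M rule: less_induct)
  case less
  have pos: "threshold M > 0" using less.prems by (rule threshold_pos)
  define n where "n = nat (\<lceil>threshold M\<rceil> - 1)"
  define f where "f = threshold M - real_of_int \<lceil>threshold M\<rceil> + 1"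
  have n: "real n = real_of_int \<lceil>threshold M\<rceil> - 1" using pos by (simp add: n_def)
  have t: "threshold M = real n + f" by (simp add: n f_def)
  have f: "0 < f" "f \<le> 1" unfolding f_def by linarith+
  show ?case
  proof (cases "f < 1 \<or> \<not> p dvd Suc n")
    case True
    with exists_threshold_frac_of_no_carry[OF less.prems t f] show ?thesis
      by (simp add: f_def)
  next
    case False
    then obtain m where m: "Suc n = p * m" by blast
    have "f = 1" using False f by simp
    then have tm: "threshold M = real (p * m)" by (simp add: t flip: m)
    obtain N where N: "\<And>i. N i > 0" "threshold N = real m"
      using exists_threshold_div[OF less.prems tm] by blast
    have "m > 0" using m by (cases m) auto
    then have "m < p * m" using p by simp
    then have "nat \<lceil>threshold N\<rceil> < nat \<lceil>threshold M\<rceil>" by (simp add: N(2) tm del: of_nat_mult)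
    from less.hyps[OF this N(1)] show ?thesis by (simp add: N(2) tm del: of_nat_mult)
  qed
qed

section \<open>Real Frobenius powers and critical exponents\<close>

text \<open>Along a sequence, membership of each monomial is eventually constant. A common index
  exists because, for bounded fractions, the ideals are generated by monomials from one finite
  set.\<close>

lemma frob_pow_monomial:
  assumes "prime p" "p = CHAR('k::field)" "t \<ge> 0"
  shows "frob_pow p (ideal_gen (monomial ` A)) t =
    {f :: ('n, 'k) mpoly. \<forall>b\<in>keys f. t < threshold (\<lambda>i. lookup b i + 1)}"
proof -
  let ?I = "ideal_gen (monomial ` A) :: ('n, 'k) mpoly set"
  define lam where "lam b = threshold (\<lambda>i. lookup b i + 1)" for b :: "'n \<Rightarrow>\<^sub>0 nat"
  have fits_iff: "fits p A k e (\<lambda>i. lookup b i + 1) \<longleftrightarrow> real k / real (p ^ e) < lam b" for k e b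
    unfolding lam_def by (subst fits_iff_threshold) (simp_all add: divide_less_eq mult.commute)
  have frac: "frob_pow_frac p ?I k (p ^ e) = {f. \<forall>b\<in>keys f. real k / real (p ^ e) < lam b}" for k e
    unfolding frob_pow_frac_monomial[OF assms(1,2)] fits_iff ..
  define J where "J = {f :: ('n, 'k) mpoly. \<forall>b\<in>keys f. t < lam b}"
  obtain D where D: "\<And>c i. c \<in> A \<Longrightarrow> lookup c i \<le> D"
  proof -
    have "finite (\<Union>c\<in>A. range (lookup c))" using finite by simp
    then have "bdd_above (\<Union>c\<in>A. range (lookup c))" by (rule bdd_above_finite)
    then show ?thesis using that unfolding bdd_above_def by blast
  qed
  have finite_bounded: "finite {b :: 'n \<Rightarrow>\<^sub>0 nat. \<forall>i. lookup b i \<le> B}" for B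
  proof -
    have "finite (lookup -` {g :: 'n \<Rightarrow> nat. \<forall>i. g i \<le> B})"
      using finite_set_of_finite_funs[of "UNIV :: 'n set" "{..B}"]
      by (intro finite_vimageI) (auto intro: injI poly_mapping_eqI)
    then show ?thesis by (rule rev_finite_subset) auto
  qed
  \<comment> \<open>Rounding the fitting sum down gives a generator dividing the monomial of
    \<open>b\<close>; its size is bounded in terms of \<open>B\<close> and \<open>D\<close>
    only.\<close>
  have small_generator: "\<exists>b'. (\<forall>i. lookup b' i \<le> B * D \<and> lookup b' i \<le> lookup b i) \<and>
      real k / real (p ^ e) < lam b'"
    if k: "real k / real (p ^ e) < lam b" "real k / real (p ^ e) \<le> real B" for k e b B
  proof -
    obtain a where a: "a \<in> digit_sums p A k" "\<And>i. lookup a i < p ^ e * (lookup b i + 1)"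
      using k(1) unfolding fits_iff[symmetric] fits_def by blast
    have "real k \<le> real (B * p ^ e)" using k(2) by (simp add: divide_le_eq)
    then have "k \<le> B * p ^ e" by (simp only: of_nat_le_iff)
    let ?b = "div_exp a (p ^ e)"
    have "lookup ?b i \<le> B * D" for i
    proof -
      have "lookup a i \<le> k * D" by (rule digit_sums_lookup_le[OF D a(1)])
      also have "\<dots> \<le> (B * p ^ e) * D" using \<open>k \<le> B * p ^ e\<close> by (rule mult_le_mono1)
      finally have "lookup a i div p ^ e \<le> (B * D) * p ^ e div p ^ e"
        by (intro div_le_mono) (simp add: ac_simps)
      then show ?thesis by simp
    qed
    moreover have "lookup ?b i \<le> lookup b i" for i
      using a(2)[of i] less_mult_imp_div_less[of "lookup a i" "lookup b i + 1" "p ^ e"]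
      by (simp add: mult.commute)
    moreover have "lookup a i < p ^ e * (lookup ?b i + 1)" for i
      using dividend_less_times_div[of "p ^ e" "lookup a i"] by simp
    then have "fits p A k e (\<lambda>i. lookup ?b i + 1)" unfolding fits_def using a(1) by blast
    ultimately show ?thesis unfolding fits_iff by blast
  qed
  have lam_mono: "lam b' \<le> lam b" if "\<And>i. lookup b' i \<le> lookup b i" for b b'
    unfolding lam_def using that by (intro threshold_mono) auto
  have stable: "\<forall>\<^sub>F j in sequentially. frob_pow_frac p ?I (k j) (p ^ e j) = J"
    if dec: "decseq (\<lambda>j. real (k j) / real (p ^ e j))"
      and gt: "\<And>j. t < real (k j) / real (p ^ e j)"
      and lim: "(\<lambda>j. real (k j) / real (p ^ e j)) \<longlonglongrightarrow> t" for k e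
  proof -
    define x where "x j = real (k j) / real (p ^ e j)" for j
    obtain B :: nat where B: "x 0 \<le> real B" using real_arch_simple by blast
    have xB: "x j \<le> real B" for j
      using decseqD[OF dec, of 0 j] B unfolding x_def by simp
    have "\<forall>\<^sub>F j in sequentially. x j < lam b" if "t < lam b" for b
      using order_tendstoD(2)[OF lim that] by (simp add: x_def)
    then have "\<forall>\<^sub>F j in sequentially.
        \<forall>b\<in>{b. \<forall>i. lookup b i \<le> B * D} \<inter> {b. t < lam b}. x j < lam b"
      using finite_bounded[of "B * D"] by (intro eventually_ball_finite) auto
    then show ?thesis
    proof (rule eventually_mono)
      fix j assume j: "\<forall>b\<in>{b. \<forall>i. lookup b i \<le> B * D} \<inter> {b. t < lam b}. x j < lam b"
      have "x j < lam b \<longleftrightarrow> t < lam b" for b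
      proof
        assume "t < lam b"
        then have "\<forall>\<^sub>F j in sequentially. x j < lam b"
          using order_tendstoD(2)[OF lim] by (simp add: x_def)
        \<comment> \<open>Some \<open>x l\<close> lies below \<open>lam b\<close>. The generator
          \<open>b'\<close> found there is bounded and has \<open>t < lam b'\<close>, so the choice
          of \<open>j\<close> applies to it, and the bound passes to its multiple
          \<open>b\<close>.\<close>
        then obtain l where l: "x l < lam b" by (meson eventually_happens' sequentially_bot)
        obtain b' where b': "\<And>i. lookup b' i \<le> B * D" "\<And>i. lookup b' i \<le> lookup b i"
            "x l < lam b'"
          using small_generator[of "k l" "e l" b B] l xB[of l] unfolding x_def by blast
        have "t < lam b'" using b'(3) gt[of l] by (simp add: x_def)
        with j b'(1) have "x j < lam b'" by blast
        also have "\<dots> \<le> lam b" using b'(2) by (rule lam_mono)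
        finally show "x j < lam b" .
      qed (use gt[of j] in \<open>simp add: x_def\<close>)
      then show "frob_pow_frac p ?I (k j) (p ^ e j) = J"
        unfolding frac J_def x_def by simp
    qed
  qed
  \<comment> \<open>The least numerators with \<open>k0 j / p ^ j\<close> greater than
    \<open>t\<close>. One such sequence suffices to make the ideal in the definition of
    \<open>frob_pow\<close> unique.\<close>
  define k0 where "k0 j = nat \<lfloor>real p ^ j * t\<rfloor> + 1" for j
  have k0: "real p ^ j * t < real (k0 j)" "real (k0 j) \<le> real p ^ j * t + 1" for j
  proof -
    have "0 \<le> real p ^ j * t" using assms(3) by simp
    then show "real p ^ j * t < real (k0 j)" "real (k0 j) \<le> real p ^ j * t + 1"
      unfolding k0_def by linarith+
  qed
  have k0_gt: "t < real (k0 j) / real (p ^ j)" for j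
    using k0(1)[of j] by (simp add: less_divide_eq mult.commute)
  have k0_dec: "decseq (\<lambda>j. real (k0 j) / real (p ^ j))"
  proof (rule decseq_SucI)
    fix j
    have "real p * (real p ^ j * t) < real p * real (k0 j)" using k0(1)[of j] by simp
    then have "real (k0 (Suc j)) < real (p * k0 j) + 1"
      using k0(2)[of "Suc j"] unfolding power_Suc mult.assoc of_nat_mult by linarith
    then have "k0 (Suc j) \<le> p * k0 j" by linarith
    then have "real (k0 (Suc j)) \<le> real p * real (k0 j)" by (metis of_nat_le_iff of_nat_mult)
    then show "real (k0 (Suc j)) / real (p ^ Suc j) \<le> real (k0 j) / real (p ^ j)"
      using p by (simp add: divide_le_eq mult.commute)
  qed
  have k0_lim: "(\<lambda>j. real (k0 j) / real (p ^ j)) \<longlonglongrightarrow> t"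
  proof (rule tendsto_sandwich[of "\<lambda>_. t" _ _ "\<lambda>j. t + (1 / real p) ^ j"])
    have "(\<lambda>j. t + (1 / real p) ^ j) \<longlonglongrightarrow> t + 0"
      using p by (intro tendsto_add tendsto_const LIMSEQ_power_zero) auto
    then show "(\<lambda>j. t + (1 / real p) ^ j) \<longlonglongrightarrow> t" by simp
    show "\<forall>\<^sub>F j in sequentially. real (k0 j) / real (p ^ j) \<le> t + (1 / real p) ^ j"
    proof (rule always_eventually, rule allI)
      fix j
      have "real (k0 j) / real (p ^ j) \<le> (real p ^ j * t + 1) / real (p ^ j)"
        using k0(2)[of j] by (intro divide_right_mono) auto
      then show "real (k0 j) / real (p ^ j) \<le> t + (1 / real p) ^ j"
        by (simp add: add_divide_distrib power_one_over)
    qed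
    show "\<forall>\<^sub>F j in sequentially. t \<le> real (k0 j) / real (p ^ j)"
      using k0_gt by (simp add: less_imp_le)
  qed (rule tendsto_const)
  have "frob_pow p ?I t = J"
    unfolding frob_pow_def
  proof (rule the_equality)
    fix J' assume J': "\<forall>(k :: nat \<Rightarrow> nat) (e :: nat \<Rightarrow> nat).
     decseq (\<lambda>j. real (k j) / real (p ^ e j)) \<longrightarrow>
     (\<forall>j. t < real (k j) / real (p ^ e j)) \<longrightarrow>
     (\<lambda>j. real (k j) / real (p ^ e j)) \<longlonglongrightarrow> t \<longrightarrow>
     (\<forall>\<^sub>F j in sequentially. frob_pow_frac p ?I (k j) (p ^ e j) = J')"
    have "\<forall>\<^sub>F j in sequentially. frob_pow_frac p ?I (k0 j) (p ^ j) = J'"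
      using J'[rule_format, of k0 "\<lambda>j. j"] k0_dec k0_gt k0_lim by simp
    moreover have "\<forall>\<^sub>F j in sequentially. frob_pow_frac p ?I (k0 j) (p ^ j) = J"
      using stable[of k0 "\<lambda>j. j"] k0_dec k0_gt k0_lim by simp
    ultimately have "\<forall>\<^sub>F j :: nat in sequentially. J' = J"
      by eventually_elim simp
    then show "J' = J" by simp
  qed (use stable in blast)
  then show ?thesis by (simp add: J_def lam_def)
qed

text \<open>The monomial with exponent \<open>M - 1\<close> lies in all Frobenius powers below the
  threshold and drops out exactly there.\<close>

lemma critical_exponent_threshold:
  assumes "prime p" "p = CHAR('k::field)" and M: "\<And>i. M i > 0"
  shows "critical_exponent p (ideal_gen (monomial ` A) :: ('n, 'k) mpoly set) (threshold M)"
proof -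
  define b where "b = Abs_poly_mapping (\<lambda>i. M i - 1)"
  have "(\<lambda>i. lookup b i + 1) = M"
    using M by (auto simp: b_def fun_eq_iff)
  then have mem: "(monomial b :: ('n, 'k) mpoly) \<in> frob_pow p (ideal_gen (monomial ` A)) t \<longleftrightarrow>
      t < threshold M" if "t \<ge> 0" for t
    using frob_pow_monomial[OF assms(1,2) that] by simp
  have "threshold M > 0" using M by (rule threshold_pos)
  then show ?thesis
    unfolding critical_exponent_def using mem by (metis less_irrefl less_imp_le)
qed

lemma crit_exp_eq_threshold:
  assumes "prime p" "p = CHAR('k::field)"
  shows "crit_exp p (ideal_gen (monomial ` A) :: ('n, 'k) mpoly set) b =
    threshold (\<lambda>i. lookup b i + 1)"
proof -
  let ?t = "threshold (\<lambda>i. lookup b i + 1)"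
  have "{t. 0 \<le> t \<and> (monomial b :: ('n, 'k) mpoly) \<in> frob_pow p (ideal_gen (monomial ` A)) t} =
      {0..<?t}"
    using frob_pow_monomial[OF assms] by auto
  then show ?thesis
    unfolding crit_exp_def by (simp add: cSup_atLeastLessThan threshold_pos)
qed

end

theorem corollary3p10:
  fixes p :: nat
    and A :: "('n::finite \<Rightarrow>\<^sub>0 nat) set"
    and I :: "('n, 'k::field) mpoly set"
    and b :: "'n \<Rightarrow>\<^sub>0 nat"
    and l :: real
  assumes "prime p"
    and "CHAR('k) = p"
    and "F_finite TYPE('k)"
    and "finite A" and "A \<noteq> {}"
    and "I = ideal_gen (monomial ` A)"
    and "I \<noteq> UNIV"
    and "l = crit_exp p I b"
    and "critical_exponent p I l"
  shows "critical_exponent p I (real p * l) \<and>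
         critical_exponent p I (real p * l - real_of_int \<lceil>real p * l\<rceil> + 1)"
proof -
  have "0 \<notin> A"
  proof
    assume "0 \<in> A"
    then have "A + UNIV = UNIV" by (force simp: set_plus_def)
    with assms(6,7) show False by (simp add: ideal_gen_monomial)
  qed
  then interpret frobenius_exponents p A
    using assms by unfold_locales (auto simp: prime_ge_2_nat)
  have p: "p = CHAR('k)" using assms(2) by simp
  \<comment> \<open>By scaling, the threshold of this \<open>M\<close> is \<open>p * l\<close>; both
    claims then say that certain thresholds are critical.\<close>
  define M where "M = (\<lambda>i. p * (lookup b i + 1))"
  have M: "M i > 0" for i by (simp add: M_def)
  have "threshold M = real p * l"
    using threshold_scale[of "\<lambda>i. lookup b i + 1"] crit_exp_eq_threshold[OF assms(1) p]
    by (simp add: M_def assms(6,8))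
  moreover obtain N where "\<And>i. N i > 0"
      "threshold N = threshold M - real_of_int \<lceil>threshold M\<rceil> + 1"
    using exists_threshold_frac[of M, OF M] by blast
  ultimately show ?thesis
    using critical_exponent_threshold[OF assms(1) p, of M, OF M]
      critical_exponent_threshold[OF assms(1) p, of N] by (simp add: assms(6))
qed

end
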